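(* Let $K_F$ be the class of all space-group pairs $(X,G)$ such that: (1) $X$ is regular, first countable and has no isolated points. (2) For every $x\in X$ and every open neighborhood $U$ of $x$, the set $\{g(x) : g\in G \text{ and } g\restriction (X\setminus U)=\mathrm{Id}\}$ is somewhere dense in $X$. (3) The family of strongly flexible sets (with respect to $(X,G)$) is a cover of $X$. Then $K_F$ is faithful.
   Context: For a topological space $X$, $H(X)$ is the group of all auto-homeomorphisms of $X$. A space-group pair is a pair $(X,G)$ where $X$ is a topological space and $G$ is a subgroup of $H(X)$. A class $K$ of space-group pairs is faithful if for every $(X,G),(Y,H)\in K$ and every group isomorphism $\varphi:G\to H$ there is a homeomorphism $\tau$ from $X$ onto $Y$ such that $\varphi(g)=\tau\circ g\circ\tau^{-1}$ for every $g\in G$. A subset of $X$ is somewhere dense if its closure has nonempty interior. Regular spaces are understood to be Hausdorff. Let $(X,G)$ be a space-group pair and $S\subseteq X$ be open. $S$ is strongly flexible if for every infinite $A\subseteq S$ without accumulation points in $X$ there is a nonempty open set $V\subseteq X$ such that for every nonempty open set $W\subseteq V$ there is $g\in G$ such that both sets $\{a\in A : g(a)\in W\}$ and $\{a\in A : \text{for some neighborhood } U \text{ of } a,\ g\restriction U=\mathrm{Id}\}$ are infinite. *)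

theory Defs
  imports "HOL-Analysis.Abstract_Metric_Spaces" "HOL-Algebra.Bij"
begin

text \<open>
  Auto-homeomorphisms are taken to be extensional on the underlying set, so that distinct
  elements differ at a point of the space; multiplication is composition restricted to that set,
  as in \<^const>\<open>BijGroup\<close>.
\<close>

definition homeo_group :: "'a topology \<Rightarrow> ('a \<Rightarrow> 'a) monoid"
  where "homeo_group X =
    (BijGroup (topspace X))\<lparr>carrier := {f \<in> extensional (topspace X). homeomorphic_map X X f}\<rparr>"

lemma subgroup_homeo_group_BijGroup:
  "subgroup (carrier (homeo_group X)) (BijGroup (topspace X))"
proof (rule group.subgroupI[OF group_BijGroup])
  let ?S = "topspace X"
  let ?C = "carrier (homeo_group X)"
  show sub: "?C \<subseteq> carrier (BijGroup ?S)"
    by (auto simp: homeo_group_def BijGroup_def Bij_def bij_betw_def homeomorphic_eq_everything_map)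
  have id: "(\<lambda>x\<in>?S. x) \<in> ?C"
    by (auto simp: homeo_group_def intro: homeomorphic_map_eq[of X X id])
  then show "?C \<noteq> {}" by blast
  show "inv\<^bsub>BijGroup ?S\<^esub> f \<in> ?C" if f: "f \<in> ?C" for f
  proof -
    have "f \<in> Bij ?S" using sub f by (auto simp: BijGroup_def)
    then have inv: "inv\<^bsub>BijGroup ?S\<^esub> f = (\<lambda>x\<in>?S. inv_into ?S f x)"
      by (rule inv_BijGroup)
    have h: "homeomorphic_map X X f" using f by (simp add: homeo_group_def)
    then obtain g where g: "homeomorphic_maps X X f g"
      by (auto simp: homeomorphic_map_maps)
    then have "homeomorphic_map X X g"
      using homeomorphic_map_maps homeomorphic_maps_sym by blast
    moreover have "g x = inv_into ?S f x" if "x \<in> ?S" for x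
    proof -
      have "g x \<in> ?S" and fgx: "f (g x) = x"
        using g that by (auto simp: homeomorphic_maps_def continuous_map_def)
      moreover have "inj_on f ?S" using h by (simp add: homeomorphic_map_def)
      ultimately show ?thesis using inv_into_f_f[of f ?S "g x"] by simp
    qed
    ultimately have "homeomorphic_map X X (\<lambda>x\<in>?S. inv_into ?S f x)"
      by (auto intro: homeomorphic_map_eq)
    then show ?thesis by (simp add: inv homeo_group_def)
  qed
  show "f \<otimes>\<^bsub>BijGroup ?S\<^esub> g \<in> ?C" if fg: "f \<in> ?C" "g \<in> ?C" for f g
  proof -
    have "f \<in> Bij ?S" "g \<in> Bij ?S" using sub fg by (auto simp: BijGroup_def)
    then have eq: "f \<otimes>\<^bsub>BijGroup ?S\<^esub> g = compose ?S f g" by (simp add: BijGroup_def)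
    have "homeomorphic_map X X (f \<circ> g)"
      using fg by (auto simp: homeo_group_def intro: homeomorphic_map_compose)
    then have "homeomorphic_map X X (compose ?S f g)"
      by (rule homeomorphic_map_eq) (simp add: compose_def)
    then show ?thesis by (simp add: eq homeo_group_def)
  qed
qed

lemma group_homeo_group: "group (homeo_group X)"
proof -
  have "homeo_group X = (BijGroup (topspace X))\<lparr>carrier := carrier (homeo_group X)\<rparr>"
    by (simp add: homeo_group_def)
  then show ?thesis
    using subgroup.subgroup_is_group[OF subgroup_homeo_group_BijGroup[of X] group_BijGroup] by metis
qed

definition space_group_pair :: "'a topology \<times> ('a \<Rightarrow> 'a) set \<Rightarrow> bool"
  where "space_group_pair = (\<lambda>(X, G). subgroup G (homeo_group X))"

text \<open>
  A class of space-group pairs over arbitrary spaces corresponds to a polymorphic constant; the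
  arguments \<open>K\<close> and \<open>L\<close> below are meant to be the instances of one such constant
  at the type of points of \<open>X\<close> and at the type of points of \<open>Y\<close>, which need
  not coincide.
\<close>

definition faithful ::
  "('a topology \<times> ('a \<Rightarrow> 'a) set) set \<Rightarrow> ('b topology \<times> ('b \<Rightarrow> 'b) set) set \<Rightarrow> bool"
  where "faithful K L \<longleftrightarrow>
    (\<forall>(X, G)\<in>K. \<forall>(Y, H)\<in>L.
      \<forall>\<phi>\<in>iso ((homeo_group X)\<lparr>carrier := G\<rparr>) ((homeo_group Y)\<lparr>carrier := H\<rparr>).
        \<exists>\<tau>. homeomorphic_map X Y \<tau> \<and>
          (\<forall>g\<in>G. \<phi> g = restrict (\<tau> \<circ> g \<circ> inv_into (topspace X) \<tau>) (topspace Y)))"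

definition somewhere_dense :: "'a topology \<Rightarrow> 'a set \<Rightarrow> bool"
  where "somewhere_dense X A \<longleftrightarrow> X interior_of (X closure_of A) \<noteq> {}"

definition strongly_flexible :: "'a topology \<Rightarrow> ('a \<Rightarrow> 'a) set \<Rightarrow> 'a set \<Rightarrow> bool"
  where "strongly_flexible X G S \<longleftrightarrow>
    openin X S \<and>
    (\<forall>A. A \<subseteq> S \<and> infinite A \<and> X derived_set_of A = {} \<longrightarrow>
      (\<exists>V. openin X V \<and> V \<noteq> {} \<and>
        (\<forall>W. openin X W \<and> W \<noteq> {} \<and> W \<subseteq> V \<longrightarrow>
          (\<exists>g\<in>G. infinite {a \<in> A. g a \<in> W} \<and>
            infinite {a \<in> A. \<exists>U. openin X U \<and> a \<in> U \<and> (\<forall>u\<in>U. g u = u)}))))"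

definition K_F :: "('a topology \<times> ('a \<Rightarrow> 'a) set) set"
  where "K_F = {(X, G).
    space_group_pair (X, G) \<and>
    regular_space X \<and> Hausdorff_space X \<and> first_countable X \<and>
    (\<forall>x\<in>topspace X. \<not> openin X {x}) \<and>
    (\<forall>x U. openin X U \<and> x \<in> U \<longrightarrow>
      somewhere_dense X {g x |g. g \<in> G \<and> (\<forall>y\<in>topspace X - U. g y = y)}) \<and>
    \<Union>{S. strongly_flexible X G S} = topspace X}"

end

theory Submission
  imports Defs
begin

text \<open>
  Let the isomorphism turn the source group into one group \<open>G\<close> acting faithfully on both spaces.
  Disjointness of the supports of two elements of \<open>G\<close> is expressible in the group alone (a
  commutator criterion due to Rubin, in the form given by Belk, Elliott and Matucci), so it means
  the same in \<open>X\<close> and in \<open>Y\<close>. Hence an open \<open>U\<close> in \<open>X\<close> has an image in \<open>Y\<close>: the union of the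
  \<open>Y\<close>-supports of the elements whose \<open>X\<close>-support lies in \<open>U\<close>. Call \<open>x\<close> and \<open>y\<close> near if the image of
  every neighbourhood of \<open>x\<close> meets every neighbourhood of \<open>y\<close>; nearness is symmetric in the two
  spaces, and it is the graph of the required homeomorphism.

  Existence: move \<open>x\<close> by \<open>G\<close> so that the images of a base \<open>U n\<close> at \<open>x\<close> essentially lie in a strongly
  flexible set, and pick distinct \<open>y n\<close> in these images. If they had no accumulation point, the
  elements \<open>g\<close> given by strong flexibility would fix \<open>x\<close>, since \<open>g\<close> is the identity near infinitely
  many \<open>y n\<close>, and yet move infinitely many \<open>y n\<close> into \<open>W\<close>, so that \<open>x\<close> would lie in the closure of
  the part of \<open>X\<close> matching \<open>W\<close>, for every small open \<open>W\<close>. Uniqueness: if \<open>x\<close> is near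
  \<open>y\<close> and \<open>z\<close>, then elements supported near \<open>y\<close> are the identity near \<open>z\<close>, hence fix \<open>x\<close>, but they
  move \<open>y\<close> over a somewhere dense set, all of whose points would be near \<open>x\<close>.
\<close>

section \<open>Group-theoretic disjointness\<close>

context group
begin

definition centralizer :: "'a \<Rightarrow> 'a set"
  where "centralizer g = {c \<in> carrier G. c \<otimes> g = g \<otimes> c}"

definition commutator :: "'a \<Rightarrow> 'a \<Rightarrow> 'a"
  where "commutator f g = f \<otimes> g \<otimes> inv f \<otimes> inv g"

text \<open>For locally moving actions this follows from disjointness of the supports of
  \<open>f\<close> and \<open>g\<close>, but the converse obtained below only separates the support
  of \<open>f\<close> from that of \<open>g [^] 12\<close>. \<open>independent\<close> bridges this
  gap.\<close>

definition alg_disjoint :: "'a \<Rightarrow> 'a \<Rightarrow> bool"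
  where "alg_disjoint f g \<longleftrightarrow>
    (\<forall>h \<in> carrier G. h \<otimes> f \<noteq> f \<otimes> h \<longrightarrow>
      (\<exists>f1 \<in> centralizer g. \<exists>f2 \<in> centralizer g.
        commutator f1 (commutator f2 h) \<in> centralizer g - {\<one>}))"

text \<open>For a locally moving action, the \<open>u\<close> commuting with these powers for
  \<open>f\<close> alone are the elements supported in the closure of the support of
  \<open>f\<close>. That only the identity qualifies for both \<open>f\<close> and \<open>k\<close>
  expresses disjointness.\<close>

definition independent :: "'a \<Rightarrow> 'a \<Rightarrow> bool"
  where "independent f k \<longleftrightarrow>
    (\<forall>u \<in> carrier G.
      (\<forall>g \<in> carrier G. alg_disjoint f g \<or> alg_disjoint k g \<longrightarrow>
        u \<otimes> (g [^] (12::nat)) = (g [^] (12::nat)) \<otimes> u) \<longrightarrow> u = \<one>)"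

lemma commutator_closed [simp]:
  "f \<in> carrier G \<Longrightarrow> g \<in> carrier G \<Longrightarrow> commutator f g \<in> carrier G"
  by (simp add: commutator_def)

lemma commutator_eq_one_iff:
  assumes "f \<in> carrier G" "g \<in> carrier G"
  shows "commutator f g = \<one> \<longleftrightarrow> f \<otimes> g = g \<otimes> f"
proof -
  have "commutator f g = \<one> \<longleftrightarrow> f \<otimes> g \<otimes> inv f = g"
    using assms by (metis commutator_def inv_closed inv_inv inv_equality m_closed r_inv)
  also have "\<dots> \<longleftrightarrow> f \<otimes> g = g \<otimes> f"
    using assms by (metis inv_solve_right m_closed)
  finally show ?thesis .
qed

lemma centralizer_inv: "c \<in> centralizer g \<Longrightarrow> g \<in> carrier G \<Longrightarrow> inv c \<in> centralizer g"
  unfolding centralizer_def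
  by (simp, metis inv_closed inv_solve_left inv_solve_right m_assoc m_closed)

lemma centralizer_mult:
  "c \<in> centralizer g \<Longrightarrow> d \<in> centralizer g \<Longrightarrow> g \<in> carrier G \<Longrightarrow> c \<otimes> d \<in> centralizer g"
  unfolding centralizer_def by (simp, metis m_assoc)

lemma centralizer_commutator:
  "c \<in> centralizer g \<Longrightarrow> d \<in> centralizer g \<Longrightarrow> g \<in> carrier G \<Longrightarrow> commutator c d \<in> centralizer g"
  unfolding commutator_def by (intro centralizer_mult centralizer_inv)

text \<open>\<open>p\<close> passes \<open>inv f\<close> and cancels. Below, \<open>p\<close> will
  be the conjugate of \<open>inv f2\<close> by \<open>h\<close>, so that \<open>h\<close> drops out
  of the double commutator.\<close>

lemma commutator_mult_right:
  assumes c: "f \<in> carrier G" "g \<in> carrier G" "p \<in> carrier G" and fp: "f \<otimes> p = p \<otimes> f"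
  shows "commutator f (g \<otimes> p) = commutator f g"
proof -
  have "p \<otimes> inv f = inv f \<otimes> p"
    using c fp by (metis inv_closed inv_solve_left inv_solve_right m_assoc m_closed)
  then have "f \<otimes> (g \<otimes> p) \<otimes> inv f = f \<otimes> g \<otimes> inv f \<otimes> p"
    using c by (simp add: m_assoc)
  then have "commutator f (g \<otimes> p) = f \<otimes> g \<otimes> inv f \<otimes> p \<otimes> (inv p \<otimes> inv g)"
    using c by (simp add: commutator_def inv_mult_group)
  also have "\<dots> = f \<otimes> g \<otimes> inv f \<otimes> (p \<otimes> inv p \<otimes> inv g)"
    using c by (simp only: m_assoc m_closed inv_closed)
  finally show ?thesis using c by (simp add: commutator_def)
qed

end

section \<open>Faithful actions by homeomorphisms\<close>

locale homeo_action = group G for G (structure) +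
  fixes X :: "'x topology" and act :: "'a \<Rightarrow> 'x \<Rightarrow> 'x"
  assumes act_hom: "act \<in> hom G (homeo_group X)"
    and act_inj: "inj_on act (carrier G)"
    and Hausdorff: "Hausdorff_space X"
begin

text \<open>No closure is taken: the set is open in a Hausdorff space, so further elements can be
  found inside a nonempty support.\<close>

definition supp :: "'a \<Rightarrow> 'x set"
  where "supp g = {x \<in> topspace X. act g x \<noteq> x}"

lemma act_homeo: "g \<in> carrier G \<Longrightarrow> homeomorphic_map X X (act g)"
  using act_hom by (auto simp: hom_def homeo_group_def)

lemma act_extensional: "g \<in> carrier G \<Longrightarrow> act g \<in> extensional (topspace X)"
  using act_hom by (auto simp: hom_def homeo_group_def)

lemma act_cont: "g \<in> carrier G \<Longrightarrow> continuous_map X X (act g)"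
  using act_homeo homeomorphic_imp_continuous_map by blast

lemma act_closed [simp]: "g \<in> carrier G \<Longrightarrow> x \<in> topspace X \<Longrightarrow> act g x \<in> topspace X"
  using act_cont continuous_map_image_subset_topspace by fastforce

lemma act_mult [simp]:
  assumes "g \<in> carrier G" "h \<in> carrier G" "x \<in> topspace X"
  shows "act (g \<otimes> h) x = act g (act h x)"
proof -
  \<comment> \<open>Multiplication in \<open>BijGroup\<close> is \<open>compose\<close> only for
    arguments in \<open>Bij\<close>.\<close>
  have B: "act k \<in> Bij (topspace X)" if "k \<in> carrier G" for k
    using act_homeo[OF that] act_extensional[OF that]
    by (auto simp: Bij_def bij_betw_def homeomorphic_eq_everything_map)
  have "act (g \<otimes> h) = act g \<otimes>\<^bsub>homeo_group X\<^esub> act h"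
    using act_hom assms by (simp add: hom_def)
  also have "\<dots> = compose (topspace X) (act g) (act h)"
    using B assms by (simp add: homeo_group_def BijGroup_def)
  finally show ?thesis using assms by (simp add: compose_def)
qed

lemma act_one [simp]: assumes "x \<in> topspace X" shows "act \<one> x = x"
proof -
  have "act \<one> (act \<one> x) = act \<one> x"
    using act_mult[of \<one> \<one> x] assms by simp
  moreover have "inj_on (act \<one>) (topspace X)"
    using act_homeo[of \<one>] by (simp add: homeomorphic_eq_everything_map)
  ultimately show ?thesis
    using assms act_closed[of \<one> x] by (simp add: inj_on_eq_iff)
qed

lemma act_inv [simp]:
  assumes "g \<in> carrier G" "x \<in> topspace X"
  shows "act (inv g) (act g x) = x" "act g (act (inv g) x) = x"
  using act_mult[of "inv g" g x] act_mult[of g "inv g" x] assms by simp_all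

lemma act_inject:
  assumes "g \<in> carrier G" "x \<in> topspace X" "y \<in> topspace X"
  shows "act g x = act g y \<longleftrightarrow> x = y"
  using act_inv assms by metis

lemma act_faithful:
  assumes "f \<in> carrier G" "g \<in> carrier G" "\<And>x. x \<in> topspace X \<Longrightarrow> act f x = act g x"
  shows "f = g"
proof -
  have "act f = act g"
    by (rule extensionalityI[of _ "topspace X"]) (use assms act_extensional in auto)
  then show ?thesis using act_inj assms by (auto dest: inj_onD)
qed

lemma supp_subset: "supp g \<subseteq> topspace X"
  by (auto simp: supp_def)

lemma supp_nonempty: assumes "g \<in> carrier G" "g \<noteq> \<one>" shows "supp g \<noteq> {}"
proof
  assume "supp g = {}"
  then have "g = \<one>" using assms by (intro act_faithful) (auto simp: supp_def)
  then show False using assms by simp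
qed

lemma supp_one [simp]: "supp \<one> = {}"
  by (auto simp: supp_def)

lemma act_preimage_open:
  "g \<in> carrier G \<Longrightarrow> openin X U \<Longrightarrow> openin X {x \<in> topspace X. act g x \<in> U}"
  using act_cont openin_continuous_map_preimage by blast

text \<open>Separate \<open>x\<close> from its image and pull the neighbourhood of the image back
  along \<open>act g\<close>.\<close>

lemma separate_one:
  assumes g: "g \<in> carrier G" and U: "openin X U" "x \<in> U" and m: "act g x \<noteq> x"
  shows "\<exists>V. openin X V \<and> x \<in> V \<and> V \<subseteq> U \<and> (\<forall>v \<in> V. act g v \<notin> V)"
proof -
  have x: "x \<in> topspace X" using U openin_subset by blast
  then obtain P Q where PQ: "openin X P" "openin X Q" "act g x \<in> P" "x \<in> Q" "disjnt P Q"
    using Hausdorff g m unfolding Hausdorff_space_def by (metis act_closed)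
  let ?V = "{x \<in> topspace X. act g x \<in> P} \<inter> Q \<inter> U"
  show ?thesis
    by (rule exI[of _ ?V]) (use PQ U x act_preimage_open[OF g PQ(1)] in \<open>auto simp: disjnt_iff\<close>)
qed

lemma separate:
  assumes "finite F" "F \<subseteq> carrier G" "openin X U" "x \<in> U" "\<And>g. g \<in> F \<Longrightarrow> act g x \<noteq> x"
  shows "\<exists>V. openin X V \<and> x \<in> V \<and> V \<subseteq> U \<and> (\<forall>g \<in> F. \<forall>v \<in> V. act g v \<notin> V)"
  using assms
proof (induction F)
  case empty
  then show ?case by blast
next
  case (insert g F)
  then obtain V where V: "openin X V" "x \<in> V" "V \<subseteq> U" "\<forall>g \<in> F. \<forall>v \<in> V. act g v \<notin> V"
    by auto
  have "g \<in> carrier G" "act g x \<noteq> x" using insert.prems by auto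
  from separate_one[OF this(1) V(1,2) this(2)]
  obtain W where "openin X W" "x \<in> W" "W \<subseteq> V" "\<forall>v \<in> W. act g v \<notin> W"
    by blast
  with V show ?case by (intro exI[of _ W]) blast
qed

lemma supp_open: assumes "g \<in> carrier G" shows "openin X (supp g)"
proof (subst openin_subopen, safe)
  fix x assume "x \<in> supp g"
  then have "x \<in> topspace X" "act g x \<noteq> x" by (auto simp: supp_def)
  from separate_one[OF assms openin_topspace this]
  obtain V where V: "openin X V" "x \<in> V" "V \<subseteq> topspace X" "\<forall>v \<in> V. act g v \<notin> V"
    by blast
  then have "V \<subseteq> supp g" unfolding supp_def by force
  with V show "\<exists>T. openin X T \<and> x \<in> T \<and> T \<subseteq> supp g" by blast
qed

lemma supp_act: "g \<in> carrier G \<Longrightarrow> x \<in> topspace X \<Longrightarrow> act g x \<in> supp g \<longleftrightarrow> x \<in> supp g"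
  by (auto simp: supp_def act_inject)

lemma supp_inv: assumes "g \<in> carrier G" shows "supp (inv g) = supp g"
proof -
  have "act (inv g) x = x \<longleftrightarrow> act g x = x" if "x \<in> topspace X" for x
    using act_inv[OF assms that] by metis
  then show ?thesis by (auto simp: supp_def)
qed

lemma supp_mult:
  "f \<in> carrier G \<Longrightarrow> g \<in> carrier G \<Longrightarrow> supp (f \<otimes> g) \<subseteq> supp f \<union> supp g"
  by (auto simp: supp_def)

text \<open>This is the translate of \<open>supp f\<close> by \<open>g\<close>, written as a
  preimage under \<open>inv g\<close>.\<close>

lemma supp_conj:
  assumes "f \<in> carrier G" "g \<in> carrier G"
  shows "supp (g \<otimes> f \<otimes> inv g) = {x \<in> topspace X. act (inv g) x \<in> supp f}"
proof -
  have "act g (act f (act (inv g) x)) = x \<longleftrightarrow> act f (act (inv g) x) = act (inv g) x"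
    if "x \<in> topspace X" for x
    using act_inv[OF assms(2)] that assms by (metis act_closed inv_closed)
  then show ?thesis using assms by (auto simp: supp_def)
qed

lemma commute_if_supp_disjoint:
  assumes "f \<in> carrier G" "g \<in> carrier G" "supp f \<inter> supp g = {}"
  shows "f \<otimes> g = g \<otimes> f"
proof (rule act_faithful)
  fix x assume x: "x \<in> topspace X"
  show "act (f \<otimes> g) x = act (g \<otimes> f) x"
  proof (cases "x \<in> supp f")
    case True
    then have "act f x \<notin> supp g" "x \<notin> supp g" using assms x supp_act by blast+
    then show ?thesis using assms x by (simp add: supp_def)
  next
    case False
    then have "act g x \<notin> supp f"
    proof (cases "x \<in> supp g")
      case True
      then have "act g x \<in> supp g" using assms x supp_act by blast
      then show ?thesis using assms by blast
    qed (use False x in \<open>auto simp: supp_def\<close>)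
    then show ?thesis using False assms x by (simp add: supp_def)
  qed
qed (use assms in auto)

text \<open>An element commuting with \<open>g\<close> maps the support of \<open>g\<close> into
  itself.\<close>

lemma not_commute_if_moved:
  assumes "f \<in> carrier G" "g \<in> carrier G" "x \<in> supp g" "act f x \<notin> supp g"
  shows "f \<otimes> g \<noteq> g \<otimes> f"
proof
  assume "f \<otimes> g = g \<otimes> f"
  then have "act f (act g x) = act g (act f x)"
    using assms supp_subset by (metis act_mult subsetD)
  then show False using assms by (auto simp: supp_def act_inject)
qed

end

section \<open>Recovering disjointness of supports\<close>

locale locally_moving = homeo_action +
  assumes locally_moving:
    "\<And>U. openin X U \<Longrightarrow> U \<noteq> {} \<Longrightarrow> \<exists>g \<in> carrier G. g \<noteq> \<one> \<and> supp g \<subseteq> U"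
begin

text \<open>Since \<open>h\<close> does not commute with \<open>f\<close>, it displaces some open
  \<open>U\<close> inside \<open>supp f\<close>. Elements \<open>f1\<close>, \<open>f2\<close>
  supported in \<open>U\<close> commute with \<open>g\<close>, and \<open>f1\<close> also commutes
  with the conjugate of \<open>inv f2\<close> by \<open>h\<close>, whose support lies in the
  translate of \<open>U\<close>. So the double commutator is just that of \<open>f1\<close> and
  \<open>f2\<close>.\<close>

lemma disjoint_imp_alg_disjoint:
  assumes f: "f \<in> carrier G" and g: "g \<in> carrier G" and fg: "supp f \<inter> supp g = {}"
  shows "alg_disjoint f g"
  unfolding alg_disjoint_def
proof (intro ballI impI)
  fix h assume h: "h \<in> carrier G" "h \<otimes> f \<noteq> f \<otimes> h"
  then have "supp h \<inter> supp f \<noteq> {}" using f commute_if_supp_disjoint by blast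
  then obtain x where x: "x \<in> supp f" "act h x \<noteq> x" by (auto simp: supp_def)
  obtain U where U: "openin X U" "x \<in> U" "U \<subseteq> supp f" "\<And>v. v \<in> U \<Longrightarrow> act h v \<notin> U"
    using separate_one[OF h(1) supp_open[OF f] x] by metis
  obtain f2 where f2: "f2 \<in> carrier G" "f2 \<noteq> \<one>" "supp f2 \<subseteq> U"
    using locally_moving U by blast
  obtain z where z: "z \<in> supp f2" using supp_nonempty f2 by blast
  then have "act f2 z \<noteq> z" by (simp add: supp_def)
  then obtain V where V: "openin X V" "z \<in> V" "V \<subseteq> supp f2" "\<And>v. v \<in> V \<Longrightarrow> act f2 v \<notin> V"
    using separate_one[OF f2(1) supp_open[OF f2(1)] z] by metis
  obtain f1 where f1: "f1 \<in> carrier G" "f1 \<noteq> \<one>" "supp f1 \<subseteq> V"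
    using locally_moving V by blast
  obtain w where w: "w \<in> supp f1" using supp_nonempty f1 by blast
  \<comment> \<open>\<open>f2\<close> carries \<open>w\<close> out of \<open>V\<close>, hence out of
    the support of \<open>f1\<close>.\<close>
  have ne: "f2 \<otimes> f1 \<noteq> f1 \<otimes> f2"
    by (rule not_commute_if_moved[of _ _ w]) (use f1 f2 V(4)[of w] w in auto)
  define p where "p = h \<otimes> inv f2 \<otimes> inv h"
  have p: "p \<in> carrier G" using f2 h by (simp add: p_def)
  have "supp f1 \<inter> supp p = {}"
  proof -
    have False if y: "y \<in> supp f1" "act (inv h) y \<in> supp f2" for y
    proof -
      have "y \<in> topspace X" "act (inv h) y \<in> U" "y \<in> U"
        using y f1 f2 V supp_subset by blast+
      then show False using U(4)[of "act (inv h) y"] h by simp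
    qed
    then show ?thesis using f2 h by (auto simp: p_def supp_conj supp_inv)
  qed
  then have f1p: "f1 \<otimes> p = p \<otimes> f1" using commute_if_supp_disjoint f1 p by blast
  have c: "commutator f2 h = f2 \<otimes> p" using f2 h by (simp add: commutator_def p_def m_assoc)
  have cc: "commutator f1 (commutator f2 h) = commutator f1 f2"
    unfolding c using commutator_mult_right f1 f2 p f1p by blast
  have C: "f1 \<in> centralizer g" "f2 \<in> centralizer g"
  proof -
    have "supp f1 \<inter> supp g = {}" "supp f2 \<inter> supp g = {}" using f1(3) f2(3) V(3) U(3) fg by blast+
    then show "f1 \<in> centralizer g" "f2 \<in> centralizer g"
      using commute_if_supp_disjoint f1(1) f2(1) g by (simp_all add: centralizer_def)
  qed
  have "commutator f1 f2 \<in> centralizer g - {\<one>}"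
    using centralizer_commutator[OF C g] ne commutator_eq_one_iff[OF f1(1) f2(1)] by simp
  then show "\<exists>f1 \<in> centralizer g. \<exists>f2 \<in> centralizer g.
      commutator f1 (commutator f2 h) \<in> centralizer g - {\<one>}"
    using C cc by metis
qed

lemma act_pow_fixed:
  assumes "g \<in> carrier G" "x \<in> topspace X" "act (g [^] (d::nat)) x = x"
  shows "act (g [^] (d * n)) x = x"
proof (induction n)
  case 0
  then show ?case using assms by simp
next
  case (Suc n)
  have "g [^] (d * Suc n) = g [^] d \<otimes> g [^] (d * n)"
    using assms nat_pow_mult[of g d "d * n"] by simp
  then show ?case using assms Suc by simp
qed

text \<open>The exponent 12 is the least common multiple of 1, 2, 3, 4: a point moved by the 12th power
  of \<open>g\<close> has at least five distinct images under powers of \<open>g\<close>, one more than the number of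
  translates of \<open>U\<close> needed to cover the support of the double commutator.\<close>

lemma alg_disjoint_imp_disjoint:
  assumes f: "f \<in> carrier G" and g: "g \<in> carrier G" and fg: "alg_disjoint f g"
  shows "supp f \<inter> supp (g [^] (12::nat)) = {}"
proof (rule ccontr)
  assume "supp f \<inter> supp (g [^] (12::nat)) \<noteq> {}"
  then obtain x where x: "x \<in> supp f" "x \<in> supp (g [^] (12::nat))" by blast
  then have xX: "x \<in> topspace X" by (simp add: supp_def)
  \<comment> \<open>Displacement by \<open>f\<close> keeps \<open>h\<close> below from commuting
    with \<open>f\<close>; displacement by the powers of \<open>g\<close> is contradicted by the
    pigeonhole argument at the end.\<close>
  define F where "F = insert f ((\<lambda>d::nat. g [^] d) ` {1..4})"
  have moved: "act (g [^] d) x \<noteq> x" if "d \<in> {1..4}" for d :: nat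
  proof
    assume fix_d: "act (g [^] d) x = x"
    have "d dvd 12" using that by (cases "d = 1 \<or> d = 2 \<or> d = 3 \<or> d = 4") auto
    then obtain n where "12 = d * n" by blast
    then show False using act_pow_fixed[OF g xX fix_d, of n] x by (simp add: supp_def)
  qed
  have "\<exists>U. openin X U \<and> x \<in> U \<and> U \<subseteq> topspace X \<and> (\<forall>g \<in> F. \<forall>v \<in> U. act g v \<notin> U)"
    by (rule separate) (use f g x moved xX in \<open>auto simp: F_def supp_def\<close>)
  then obtain U where U: "openin X U" "x \<in> U" "U \<subseteq> topspace X"
    and UF: "\<And>k v. k \<in> F \<Longrightarrow> v \<in> U \<Longrightarrow> act k v \<notin> U" by blast
  obtain h where h: "h \<in> carrier G" "h \<noteq> \<one>" "supp h \<subseteq> U" using locally_moving U by blast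
  obtain z where z: "z \<in> supp h" using supp_nonempty h by blast
  have "f \<otimes> h \<noteq> h \<otimes> f"
    by (rule not_commute_if_moved[of _ _ z]) (use f h z UF[of f z] in \<open>auto simp: F_def\<close>)
  then obtain f1 f2 where f12: "f1 \<in> centralizer g" "f2 \<in> centralizer g"
    and k: "commutator f1 (commutator f2 h) \<in> centralizer g - {\<one>}"
    using fg h unfolding alg_disjoint_def by metis
  define k where "k = commutator f1 (commutator f2 h)"
  have c: "f1 \<in> carrier G" "f2 \<in> carrier G" "f1 \<otimes> f2 \<in> carrier G"
    using f12 by (auto simp: centralizer_def)
  have kc: "k \<in> carrier G" "k \<noteq> \<one>" "k \<otimes> g = g \<otimes> k"
    using k by (auto simp: k_def centralizer_def)
  \<comment> \<open>Expanding both commutators covers the support of \<open>k\<close> by the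
    translates of \<open>U\<close> under these four elements, all of which commute with
    \<open>g\<close>.\<close>
  define A where "A = {\<one>, f1, f2, f1 \<otimes> f2}"
  have AC: "A \<subseteq> centralizer g"
    using f12 g centralizer_mult by (auto simp: A_def) (simp add: centralizer_def)
  have inv12: "inv (f1 \<otimes> f2) = inv f2 \<otimes> inv f1" using c by (simp add: inv_mult_group)
  have supp_c: "supp (commutator f2 h) \<subseteq> {y \<in> topspace X. act (inv f2) y \<in> U \<or> y \<in> U}"
  proof -
    have "supp (commutator f2 h) \<subseteq> supp (f2 \<otimes> h \<otimes> inv f2) \<union> supp (inv h)"
      unfolding commutator_def using c h by (intro supp_mult) auto
    then show ?thesis using c h U by (auto simp: supp_conj supp_inv)
  qed
  have supp_k: "\<exists>a \<in> A. act (inv a) y \<in> U" if y: "y \<in> supp k" for y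
  proof -
    have "supp k \<subseteq> supp (f1 \<otimes> commutator f2 h \<otimes> inv f1) \<union> supp (inv (commutator f2 h))"
      unfolding k_def commutator_def[of f1] using c h by (intro supp_mult) auto
    then have "act (inv f1) y \<in> supp (commutator f2 h) \<or> y \<in> supp (commutator f2 h)"
      using y c h by (auto simp: supp_conj supp_inv)
    moreover have "y \<in> topspace X" using y supp_subset by blast
    ultimately show ?thesis using supp_c c by (auto simp: A_def inv12)
  qed
  obtain y where y: "y \<in> supp k" using supp_nonempty kc by blast
  then have yX: "y \<in> topspace X" using supp_subset by blast
  \<comment> \<open>\<open>k\<close> commutes with \<open>g\<close>, so powers of \<open>g\<close>
    preserve its support.\<close>
  have orbit: "act (g [^] i) y \<in> supp k" for i :: nat
  proof -
    have "k \<otimes> g [^] i = g [^] i \<otimes> k"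
      using kc g by (metis group_commutes_pow)
    then have "act k (act (g [^] i) y) = act (g [^] i) (act k y)"
      using kc g yX by (metis act_mult nat_pow_closed)
    then show ?thesis using y yX kc g by (auto simp: supp_def act_inject)
  qed
  have "\<forall>i::nat. \<exists>a \<in> A. act (inv a) (act (g [^] i) y) \<in> U" using supp_k orbit by blast
  then obtain a where a: "\<And>i::nat. a i \<in> A" "\<And>i::nat. act (inv (a i)) (act (g [^] i) y) \<in> U"
    by metis
  \<comment> \<open>Five exponents share four translates, so two of the orbit points lie in the same
    one. As \<open>b\<close> commutes with \<open>g\<close>, a power of \<open>g\<close> with
    exponent between 1 and 4 then maps a point of \<open>U\<close> into \<open>U\<close>.\<close>
  have "card A \<le> 4" unfolding A_def by (simp add: card_insert_if)
  moreover have "card (a ` {0..4::nat}) \<le> card A"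
    using a by (intro card_mono) (auto simp: A_def)
  ultimately have "\<not> inj_on a {0..4::nat}"
    using card_image[of a "{0..4}"] by auto
  then obtain i j where ij: "a i = a j" "i < j" "j \<le> 4"
    unfolding inj_on_def by (metis atLeastAtMost_iff linorder_neqE_nat)
  define b where "b = inv (a i)"
  have b: "b \<in> centralizer g" using AC a(1)[of i] g centralizer_inv by (auto simp: b_def)
  then have bc: "b \<in> carrier G" by (simp add: centralizer_def)
  let ?d = "j - i"
  have comm: "b \<otimes> g [^] ?d = g [^] ?d \<otimes> b"
    using b g bc by (metis (mono_tags, lifting) centralizer_def group_commutes_pow mem_Collect_eq)
  have "g [^] j = g [^] ?d \<otimes> g [^] i" using ij g nat_pow_mult[of g ?d i] by simp
  then have "act b (act (g [^] j) y) = act (b \<otimes> g [^] ?d) (act (g [^] i) y)"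
    using bc g yX by simp
  also have "\<dots> = act (g [^] ?d) (act b (act (g [^] i) y))"
    unfolding comm using bc g yX by simp
  finally have "act (g [^] ?d) (act b (act (g [^] i) y)) \<in> U"
    using a(2)[of j] ij by (simp add: b_def)
  moreover have "act b (act (g [^] i) y) \<in> U" using a(2)[of i] by (simp add: b_def)
  moreover have "?d \<in> {1..4}" using ij by auto
  then have "g [^] ?d \<in> F" unfolding F_def by blast
  ultimately show False using UF by blast
qed

text \<open>A nontrivial element may have trivial twelfth power, so longer orbits are built by
  induction. If the next power of \<open>g\<close> fixes \<open>V\<close> pointwise,
  \<open>g\<close> is composed with a nontrivial \<open>k\<close> supported in \<open>V\<close>: the
  orbit of a point \<open>y\<close> moved by \<open>k\<close> stays outside \<open>V\<close> for
  \<open>n\<close> steps and returns as \<open>act k y\<close>.\<close>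

lemma long_orbit:
  assumes "openin X U" "U \<noteq> {}"
  shows "\<exists>g \<in> carrier G. supp g \<subseteq> U \<and> (\<exists>x \<in> U. \<forall>i \<in> {1..n::nat}. act (g [^] i) x \<noteq> x)"
proof (induction n)
  case 0
  then show ?case using assms by (intro bexI[of _ \<one>]) auto
next
  case (Suc n)
  then obtain g x where g: "g \<in> carrier G" "supp g \<subseteq> U" and x: "x \<in> U"
    "\<And>i. i \<in> {1..n} \<Longrightarrow> act (g [^] i) x \<noteq> x" by blast
  have "\<exists>V. openin X V \<and> x \<in> V \<and> V \<subseteq> U \<and> (\<forall>k \<in> (\<lambda>i. g [^] i) ` {1..n}. \<forall>v \<in> V. act k v \<notin> V)"
    by (rule separate) (use assms x g in auto)
  then obtain V where V: "openin X V" "x \<in> V" "V \<subseteq> U"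
    and gV: "\<And>i v. i \<in> {1..n} \<Longrightarrow> v \<in> V \<Longrightarrow> act (g [^] i) v \<notin> V" by blast
  show ?case
  proof (cases "\<exists>y \<in> V. act (g [^] Suc n) y \<noteq> y")
    case True
    then obtain y where y: "y \<in> V" "act (g [^] Suc n) y \<noteq> y" by blast
    then have "\<forall>i \<in> {1..Suc n}. act (g [^] i) y \<noteq> y"
      using gV by (metis atLeastAtMost_iff le_Suc_eq)
    then show ?thesis using g y V by blast
  next
    case False
    obtain k where k: "k \<in> carrier G" "k \<noteq> \<one>" "supp k \<subseteq> V" using locally_moving V by blast
    obtain y where y: "y \<in> supp k" using supp_nonempty k by blast
    then have yX: "y \<in> topspace X" and yV: "y \<in> V" using k supp_subset by blast+
    have kyV: "act k y \<in> V" using k y yX supp_act by blast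
    \<comment> \<open>After its first application \<open>k\<close> acts trivially, because the next
      \<open>n\<close> points lie outside \<open>V\<close>.\<close>
    have pow: "act ((g \<otimes> k) [^] Suc i) y = act (g [^] Suc i) (act k y)" if "i \<le> n" for i
      using that
    proof (induction i)
      case 0
      then show ?case using g k yX by simp
    next
      case (Suc i)
      let ?w = "act (g [^] Suc i) (act k y)"
      have wX: "?w \<in> topspace X" using g k yX by (simp del: nat_pow_Suc)
      have "?w \<notin> V" using gV[of "Suc i"] Suc kyV by auto
      then have w: "act k ?w = ?w" using k wX by (auto simp: supp_def)
      have "(g \<otimes> k) [^] Suc (Suc i) = (g \<otimes> k) \<otimes> (g \<otimes> k) [^] Suc i"
        using nat_pow_Suc2 g k by (metis m_closed)
      then have "act ((g \<otimes> k) [^] Suc (Suc i)) y = act g (act k ?w)"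
        using Suc g k yX wX by (simp del: nat_pow_Suc)
      also have "\<dots> = act (g \<otimes> g [^] Suc i) (act k y)" using w g k yX by (simp del: nat_pow_Suc)
      also have "g \<otimes> g [^] Suc i = g [^] Suc (Suc i)" using nat_pow_Suc2 g by metis
      finally show ?case .
    qed
    have "act ((g \<otimes> k) [^] i) y \<noteq> y" if i: "i \<in> {1..Suc n}" for i
    proof -
      obtain j where j: "i = Suc j" "j \<le> n" using i by (cases i) auto
      show ?thesis
      proof (cases "j = n")
        case True
        then have "act ((g \<otimes> k) [^] i) y = act k y" using False kyV pow j by auto
        then show ?thesis using y by (simp add: supp_def)
      next
        case False
        then have "act (g [^] i) (act k y) \<notin> V" using gV[of i] kyV j by auto
        then show ?thesis using yV pow[of j] j by metis
      qed
    qed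
    moreover have "supp (g \<otimes> k) \<subseteq> U" using supp_mult g k V by blast
    ultimately show ?thesis using g k yV V by (intro bexI[of _ "g \<otimes> k"]) blast+
  qed
qed

text \<open>In other words, \<open>supp f\<close> is dense in \<open>supp u\<close>. Otherwise an
  open set displaced by \<open>u\<close> and disjoint from \<open>supp f\<close> contains the
  support of some \<open>g\<close> with nontrivial twelfth power; this \<open>g\<close> is
  algebraically disjoint from \<open>f\<close>, yet its twelfth power does not commute with
  \<open>u\<close>.\<close>

lemma meets_supp_if_commutes_with_disjoint_powers:
  assumes u: "u \<in> carrier G" and f: "f \<in> carrier G"
    and comm: "\<And>g. g \<in> carrier G \<Longrightarrow> alg_disjoint f g \<Longrightarrow>
      u \<otimes> (g [^] (12::nat)) = (g [^] (12::nat)) \<otimes> u"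
    and W: "openin X W" "W \<noteq> {}" "W \<subseteq> supp u"
  shows "W \<inter> supp f \<noteq> {}"
proof
  assume Wf: "W \<inter> supp f = {}"
  obtain x where x: "x \<in> W" using W by blast
  then have "act u x \<noteq> x" using W by (auto simp: supp_def)
  then obtain V where V: "openin X V" "x \<in> V" "V \<subseteq> W" "\<And>v. v \<in> V \<Longrightarrow> act u v \<notin> V"
    using separate_one[OF u W(1) x] by metis
  obtain g z where g: "g \<in> carrier G" "supp g \<subseteq> V" and z: "z \<in> V" "act (g [^] (12::nat)) z \<noteq> z"
    using long_orbit[of V 12] V by fastforce
  have gs: "supp (g [^] (n::nat)) \<subseteq> supp g" for n
  proof (induction n)
    case (Suc n)
    then show ?case using supp_mult[of "g [^] n" g] g by auto
  qed simp
  have "z \<in> supp (g [^] (12::nat))" using z V openin_subset by (fastforce simp: supp_def)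
  moreover have "act u z \<notin> supp (g [^] (12::nat))" using V z gs g by blast
  ultimately have "u \<otimes> (g [^] (12::nat)) \<noteq> (g [^] (12::nat)) \<otimes> u"
    using not_commute_if_moved u g by blast
  moreover have "alg_disjoint f g"
    using disjoint_imp_alg_disjoint f g Wf V by blast
  ultimately show False using comm g by blast
qed

text \<open>The right side mentions only the group. If the supports are disjoint, both would be
  dense in the support of a counterexample \<open>u\<close>, which is absurd for open sets. If they
  meet, a nontrivial \<open>u\<close> supported in the overlap violates independence.\<close>

theorem supp_disjoint_iff_independent:
  assumes f: "f \<in> carrier G" and k: "k \<in> carrier G"
  shows "supp f \<inter> supp k = {} \<longleftrightarrow> independent f k"
proof
  assume fk: "supp f \<inter> supp k = {}"
  show "independent f k"
    unfolding independent_def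
  proof (intro ballI impI, rule ccontr)
    fix u assume u: "u \<in> carrier G" "u \<noteq> \<one>"
      and comm: "\<forall>g \<in> carrier G. alg_disjoint f g \<or> alg_disjoint k g \<longrightarrow>
        u \<otimes> (g [^] (12::nat)) = (g [^] (12::nat)) \<otimes> u"
    have "supp u \<inter> supp f \<noteq> {}"
      using meets_supp_if_commutes_with_disjoint_powers[OF u(1) f _ supp_open[OF u(1)]] comm supp_nonempty u by blast
    moreover have "openin X (supp u \<inter> supp f)" using u f supp_open by blast
    ultimately have "supp u \<inter> supp f \<inter> supp k \<noteq> {}"
      using meets_supp_if_commutes_with_disjoint_powers[OF u(1) k, of "supp u \<inter> supp f"] comm by blast
    then show False using fk by blast
  qed
next
  assume ind: "independent f k"
  show "supp f \<inter> supp k = {}"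
  proof (rule ccontr)
    assume "supp f \<inter> supp k \<noteq> {}"
    moreover have "openin X (supp f \<inter> supp k)" using f k supp_open by blast
    ultimately obtain u where u: "u \<in> carrier G" "u \<noteq> \<one>" "supp u \<subseteq> supp f \<inter> supp k"
      using locally_moving by blast
    have "u \<otimes> (g [^] (12::nat)) = (g [^] (12::nat)) \<otimes> u"
      if "g \<in> carrier G" "alg_disjoint f g \<or> alg_disjoint k g" for g
      using that u f k alg_disjoint_imp_disjoint[of f g] alg_disjoint_imp_disjoint[of k g]
      by (intro commute_if_supp_disjoint) auto
    then show False using ind u unfolding independent_def by blast
  qed
qed

end

section \<open>Recovering the points\<close>

lemma first_countable_decreasing_base:
  assumes "first_countable X" "x \<in> topspace X"
  shows "\<exists>U :: nat \<Rightarrow> 'a set. (\<forall>n. openin X (U n) \<and> x \<in> U n) \<and> decseq U \<and>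
    (\<forall>T. openin X T \<and> x \<in> T \<longrightarrow> (\<exists>n. U n \<subseteq> T))"
proof -
  from bspec[OF assms(1)[unfolded first_countable_def] assms(2)]
  obtain \<B> where B: "countable \<B>" "\<forall>V \<in> \<B>. openin X V"
    "\<forall>T. openin X T \<and> x \<in> T \<longrightarrow> (\<exists>V \<in> \<B>. x \<in> V \<and> V \<subseteq> T)"
    by (elim exE conjE) (rule that)
  define \<C> where "\<C> = {V \<in> \<B>. x \<in> V}"
  have "\<C> \<noteq> {}" using B(3)[rule_format, of "topspace X"] assms(2) unfolding \<C>_def by auto
  moreover have "countable \<C>" using B(1) by (simp add: \<C>_def)
  ultimately have C: "range (from_nat_into \<C>) = \<C>" by (rule range_from_nat_into)
  define U where "U n = \<Inter>(from_nat_into \<C> ` {..n})" for n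
  have "openin X (U n) \<and> x \<in> U n" for n
  proof -
    have "from_nat_into \<C> i \<in> \<C>" for i using C by blast
    then have "openin X (from_nat_into \<C> i) \<and> x \<in> from_nat_into \<C> i" for i
      using B(2) unfolding \<C>_def by blast
    then show ?thesis unfolding U_def by (intro conjI openin_Inter) auto
  qed
  moreover have "decseq U"
    unfolding decseq_def U_def by (intro allI impI INF_superset_mono) auto
  moreover have "\<exists>n. U n \<subseteq> T" if T: "openin X T" "x \<in> T" for T
  proof -
    obtain V where "V \<in> \<C>" "V \<subseteq> T" using B(3)[rule_format, of T] T unfolding \<C>_def by auto
    then obtain n where "from_nat_into \<C> n \<subseteq> T" using C by (metis imageE)
    then have "U n \<subseteq> T" unfolding U_def by blast
    then show ?thesis by blast
  qed
  ultimately show ?thesis by blast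
qed

text \<open>Finite sets are closed, so deleting all but one point of a finite open set would leave
  an isolated point.\<close>

lemma infinite_openin_if_no_isolated:
  assumes X: "Hausdorff_space X" "\<forall>x \<in> topspace X. \<not> openin X {x}"
    and U: "openin X U" "U \<noteq> {}"
  shows "infinite U"
proof
  assume fin: "finite U"
  obtain x where x: "x \<in> U" using U by blast
  have "U \<subseteq> topspace X" using U openin_subset by blast
  then have "closedin X (U - {x})"
    using fin X(1) by (intro closedin_Hausdorff_finite) auto
  then have "openin X (U - (U - {x}))" using U(1) by blast
  moreover have "U - (U - {x}) = {x}" using x by blast
  ultimately show False using X(2) x \<open>U \<subseteq> topspace X\<close> by auto
qed

text \<open>Recursion along the natural numbers, avoiding the finitely many earlier values.\<close>

lemma inj_choice_of_infinite:
  fixes T :: "nat \<Rightarrow> 'a set"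
  assumes "\<And>n. infinite (T n)"
  shows "\<exists>y. inj y \<and> (\<forall>n. y n \<in> T n)"
proof -
  have "\<exists>y. \<forall>n. y n \<in> T n - y ` {..<n}"
  proof (rule dependent_wf_choice[OF wf_less_than])
    fix f g :: "nat \<Rightarrow> 'a" and x :: nat and r :: 'a
    assume "\<And>z. (z, x) \<in> less_than \<Longrightarrow> f z = g z"
    then have "f ` {..<x} = g ` {..<x}" by (intro image_cong) auto
    then show "(r \<in> T x - f ` {..<x}) = (r \<in> T x - g ` {..<x})" by simp
  next
    fix n :: nat and y :: "nat \<Rightarrow> 'a"
    have "infinite (T n - y ` {..<n})" using assms by (intro Diff_infinite_finite) auto
    then show "\<exists>r. r \<in> T n - y ` {..<n}" by (metis ex_in_conv infinite_imp_nonempty)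
  qed
  then obtain y where y: "\<And>n. y n \<in> T n - y ` {..<n}" by metis
  have "y m \<noteq> y n" if "m < n" for m n
    using y[of n] that by (metis DiffE image_eqI lessThan_iff)
  then have "inj y" by (rule linorder_injI)
  moreover have "\<forall>n. y n \<in> T n" using y by (metis DiffE)
  ultimately show ?thesis by (intro exI[of _ y] conjI)
qed

section \<open>A single action satisfying the hypotheses of the class\<close>

locale K_F_action = homeo_action +
  assumes in_K_F: "(X, act ` carrier G) \<in> K_F"
begin

lemma regular: "regular_space X"
  and first_countable: "first_countable X"
  and no_isolated: "\<forall>x \<in> topspace X. \<not> openin X {x}"
  and cover: "\<Union>{S. strongly_flexible X (act ` carrier G) S} = topspace X"
  using in_K_F by (simp_all add: K_F_def)

lemma orbit_somewhere_dense:
  assumes "openin X U" "x \<in> U"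
  shows "somewhere_dense X {act g x |g. g \<in> carrier G \<and> supp g \<subseteq> U}"
proof -
  have "{act g x |g. g \<in> carrier G \<and> supp g \<subseteq> U} =
    {f x |f. f \<in> act ` carrier G \<and> (\<forall>y \<in> topspace X - U. f y = y)}"
    by (auto simp: supp_def)
  then show ?thesis using in_K_F assms by (simp add: K_F_def)
qed

text \<open>If only the identity were supported in \<open>U\<close>, the orbit of \<open>x\<close>
  in the density condition would be the closed set consisting of \<open>x\<close> alone, and its
  interior would make \<open>x\<close> isolated.\<close>

sublocale locally_moving
proof unfold_locales
  fix U assume U: "openin X U" "U \<noteq> {}"
  then obtain x where x: "x \<in> U" by blast
  then have xX: "x \<in> topspace X" using U openin_subset by blast
  show "\<exists>g \<in> carrier G. g \<noteq> \<one> \<and> supp g \<subseteq> U"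
  proof (rule ccontr)
    assume none: "\<not> (\<exists>g \<in> carrier G. g \<noteq> \<one> \<and> supp g \<subseteq> U)"
    define A where "A = {act g x |g. g \<in> carrier G \<and> supp g \<subseteq> U}"
    have "A \<subseteq> {x}"
      unfolding A_def
    proof clarify
      fix g assume "g \<in> carrier G" "supp g \<subseteq> U"
      then have "g = \<one>" using none by blast
      then show "act g x = x" using xX by simp
    qed
    then have "X closure_of A \<subseteq> {x}"
      using Hausdorff xX by (intro closure_of_minimal closedin_Hausdorff_singleton)
    then have "X interior_of (X closure_of A) \<subseteq> {x}"
      by (rule subset_trans[OF interior_of_subset])
    moreover have "X interior_of (X closure_of A) \<noteq> {}"
      using orbit_somewhere_dense[OF U(1) x] by (simp add: somewhere_dense_def A_def)
    ultimately have "X interior_of (X closure_of A) = {x}"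
      by (simp add: subset_singleton_iff)
    then show False using no_isolated xX openin_interior_of by metis
  qed
qed

end

section \<open>Open sets and nearness for two actions of one group\<close>

locale K_F_pair = A: K_F_action G X a + B: K_F_action G Y b
  for G (structure) and X :: "'x topology" and a and Y :: "'y topology" and b
begin

definition img :: "'x set \<Rightarrow> 'y set"
  where "img U = {y. \<exists>f \<in> carrier G. A.supp f \<subseteq> U \<and> y \<in> B.supp f}"

text \<open>Not a preimage under a map, but \<open>img\<close> with the two actions
  exchanged.\<close>

definition pre :: "'y set \<Rightarrow> 'x set"
  where "pre V = {x. \<exists>f \<in> carrier G. B.supp f \<subseteq> V \<and> x \<in> A.supp f}"

definition near :: "'x \<Rightarrow> 'y \<Rightarrow> bool"
  where "near x y \<longleftrightarrow> x \<in> topspace X \<and> y \<in> topspace Y \<and>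
    (\<forall>U V. openin X U \<and> x \<in> U \<and> openin Y V \<and> y \<in> V \<longrightarrow> img U \<inter> V \<noteq> {})"

lemma nearD:
  assumes "near x y"
  shows "x \<in> topspace X" "y \<in> topspace Y"
    and "openin X U \<Longrightarrow> x \<in> U \<Longrightarrow> openin Y V \<Longrightarrow> y \<in> V \<Longrightarrow> img U \<inter> V \<noteq> {}"
  using assms unfolding near_def by simp_all

lemma supp_disjoint_iff:
  "f \<in> carrier G \<Longrightarrow> k \<in> carrier G \<Longrightarrow> A.supp f \<inter> A.supp k = {} \<longleftrightarrow> B.supp f \<inter> B.supp k = {}"
  by (simp add: A.supp_disjoint_iff_independent B.supp_disjoint_iff_independent)

lemma img_open: "openin Y (img U)"
proof -
  have "img U = \<Union>{B.supp f |f. f \<in> carrier G \<and> A.supp f \<subseteq> U}" by (auto simp: img_def)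
  then show ?thesis using B.supp_open by auto
qed

lemma pre_open: "openin X (pre V)"
proof -
  have "pre V = \<Union>{A.supp f |f. f \<in> carrier G \<and> B.supp f \<subseteq> V}" by (auto simp: pre_def)
  then show ?thesis using A.supp_open by auto
qed

lemma img_mono: "U \<subseteq> U' \<Longrightarrow> img U \<subseteq> img U'"
  unfolding img_def by blast

lemma img_nonempty: assumes "openin X U" "U \<noteq> {}" shows "img U \<noteq> {}"
proof -
  obtain f where "f \<in> carrier G" "f \<noteq> \<one>" "A.supp f \<subseteq> U" using A.locally_moving assms by blast
  then show ?thesis using B.supp_nonempty[of f] unfolding img_def by blast
qed

lemma pre_nonempty: assumes "openin Y V" "V \<noteq> {}" shows "pre V \<noteq> {}"
proof -
  obtain f where "f \<in> carrier G" "f \<noteq> \<one>" "B.supp f \<subseteq> V" using B.locally_moving assms by blast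
  then show ?thesis using A.supp_nonempty[of f] unfolding pre_def by blast
qed

lemma img_disjoint: assumes "U \<inter> U' = {}" shows "img U \<inter> img U' = {}"
proof -
  have False if "f \<in> carrier G" "A.supp f \<subseteq> U" "y \<in> B.supp f"
    "k \<in> carrier G" "A.supp k \<subseteq> U'" "y \<in> B.supp k" for f k y
    using supp_disjoint_iff[of f k] that assms by blast
  then show ?thesis unfolding img_def by blast
qed

text \<open>A nontrivial element supported in the overlap on one side meets the given support on the
  other side too. This makes nearness symmetric.\<close>

lemma img_meets_iff:
  assumes U: "openin X U" and V: "openin Y V"
  shows "img U \<inter> V \<noteq> {} \<longleftrightarrow> U \<inter> pre V \<noteq> {}"
proof
  assume "img U \<inter> V \<noteq> {}"
  then obtain f where f: "f \<in> carrier G" "A.supp f \<subseteq> U" "B.supp f \<inter> V \<noteq> {}"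
    unfolding img_def by blast
  then obtain k where k: "k \<in> carrier G" "k \<noteq> \<one>" "B.supp k \<subseteq> B.supp f \<inter> V"
    using B.locally_moving V B.supp_open by (metis openin_Int)
  then have "B.supp f \<inter> B.supp k \<noteq> {}" using B.supp_nonempty by blast
  then have "A.supp f \<inter> A.supp k \<noteq> {}" using supp_disjoint_iff f k by blast
  then show "U \<inter> pre V \<noteq> {}" using f k unfolding pre_def by blast
next
  assume "U \<inter> pre V \<noteq> {}"
  then obtain f where f: "f \<in> carrier G" "B.supp f \<subseteq> V" "A.supp f \<inter> U \<noteq> {}"
    unfolding pre_def by blast
  then obtain k where k: "k \<in> carrier G" "k \<noteq> \<one>" "A.supp k \<subseteq> A.supp f \<inter> U"
    using A.locally_moving U A.supp_open by (metis openin_Int)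
  then have "A.supp f \<inter> A.supp k \<noteq> {}" using A.supp_nonempty by blast
  then have "B.supp f \<inter> B.supp k \<noteq> {}" using supp_disjoint_iff f k by blast
  then show "img U \<inter> V \<noteq> {}" using f k unfolding img_def by blast
qed

text \<open>This states that \<open>S\<close> is dense in \<open>img U\<close>, which is enough to
  find points of \<open>S\<close> there.\<close>

lemma img_subset_closure:
  assumes U: "U \<subseteq> pre S" and Q: "openin Y Q" "img U \<inter> Q \<noteq> {}"
  shows "img U \<inter> Q \<inter> S \<noteq> {}"
proof
  assume empty: "img U \<inter> Q \<inter> S = {}"
  obtain u where u: "u \<in> carrier G" "A.supp u \<subseteq> U" "B.supp u \<inter> Q \<noteq> {}"
    using Q unfolding img_def by blast
  then obtain v where v: "v \<in> carrier G" "v \<noteq> \<one>" "B.supp v \<subseteq> B.supp u \<inter> Q"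
    using B.locally_moving Q B.supp_open by (metis openin_Int)
  have vu: "B.supp v \<inter> B.supp u \<noteq> {}" using v B.supp_nonempty by blast
  then obtain x where x: "x \<in> A.supp v" "x \<in> A.supp u" using supp_disjoint_iff u v by blast
  then obtain f where f: "f \<in> carrier G" "B.supp f \<subseteq> S" "x \<in> A.supp f"
    using u U unfolding pre_def by blast
  then have "B.supp f \<inter> B.supp v \<noteq> {}" using supp_disjoint_iff v x by blast
  moreover have "B.supp u \<subseteq> img U" using u unfolding img_def by blast
  ultimately show False using f v empty by blast
qed

text \<open>Conjugation by \<open>g\<close> turns the element witnessing \<open>y\<close> into one
  supported in \<open>U\<close>, so the correspondence is equivariant.\<close>

lemma img_act:
  assumes g: "g \<in> carrier G" and y: "y \<in> img {x \<in> topspace X. a g x \<in> U}"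
  shows "b g y \<in> img U"
proof -
  obtain f where f: "f \<in> carrier G" "A.supp f \<subseteq> {x \<in> topspace X. a g x \<in> U}" "y \<in> B.supp f"
    using y unfolding img_def by blast
  have "A.supp (g \<otimes> f \<otimes> inv g) \<subseteq> U"
  proof
    fix x assume "x \<in> A.supp (g \<otimes> f \<otimes> inv g)"
    then have "x \<in> topspace X" "a (inv g) x \<in> A.supp f" using f g by (auto simp: A.supp_conj)
    then show "x \<in> U" using f(2) g by auto
  qed
  moreover have "y \<in> topspace Y" using f(3) B.supp_subset by blast
  then have "b g y \<in> B.supp (g \<otimes> f \<otimes> inv g)"
    using f g by (simp add: B.supp_conj)
  ultimately show ?thesis using f g unfolding img_def by blast
qed

lemma near_act:
  assumes g: "g \<in> carrier G" and xy: "near x y"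
  shows "near (a g x) (b g y)"
  unfolding near_def
proof (intro conjI allI impI)
  note X = nearD(1,2)[OF xy]
  then show "a g x \<in> topspace X" "b g y \<in> topspace Y" using g by auto
  fix U V assume UV: "openin X U \<and> a g x \<in> U \<and> openin Y V \<and> b g y \<in> V"
  then have "img {x \<in> topspace X. a g x \<in> U} \<inter> {y \<in> topspace Y. b g y \<in> V} \<noteq> {}"
    using X g by (intro nearD(3)[OF xy] A.act_preimage_open B.act_preimage_open) auto
  then show "img U \<inter> V \<noteq> {}" using img_act[OF g] by blast
qed

text \<open>\<open>pre V\<close> contains a point other than \<open>x\<close>; disjoint
  neighbourhoods of the two have disjoint images. Hence \<open>x\<close> is not near every point of
  a nonempty open set.\<close>

lemma separate_in:
  assumes x: "x \<in> topspace X" and V: "openin Y V" "V \<noteq> {}"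
  shows "\<exists>U W. openin X U \<and> x \<in> U \<and> openin Y W \<and> W \<noteq> {} \<and> W \<subseteq> V \<and> img U \<inter> W = {}"
proof -
  have "infinite (pre V)"
    by (rule infinite_openin_if_no_isolated[OF A.Hausdorff A.no_isolated pre_open pre_nonempty[OF V]])
  then have "\<not> pre V \<subseteq> {x}" using finite_subset[of "pre V" "{x}"] by auto
  then obtain x' where x': "x' \<in> pre V" "x' \<noteq> x" by auto
  then obtain U U' where U: "openin X U" "openin X U'" "x \<in> U" "x' \<in> U'" "disjnt U U'"
    using A.Hausdorff x pre_open[of V] openin_subset unfolding Hausdorff_space_def by (metis subsetD)
  have "img U' \<inter> V \<noteq> {}" using img_meets_iff U V x' by blast
  moreover have "img U \<inter> (img U' \<inter> V) = {}" using img_disjoint[of U U'] U by (auto simp: disjnt_def)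
  moreover have "openin Y (img U' \<inter> V)" using img_open V by blast
  ultimately show ?thesis using U by blast
qed

text \<open>If \<open>g\<close> displaced a neighbourhood \<open>U\<close> of \<open>x\<close>, an
  element \<open>u\<close> supported in \<open>U\<close> and its conjugate by \<open>g\<close> would
  have disjoint supports in \<open>X\<close>. In \<open>Y\<close> both move a point of
  \<open>N\<close> that \<open>g\<close> fixes.\<close>

lemma fixed_if_locally_fixed:
  assumes x: "x \<in> topspace X" and g: "g \<in> carrier G"
    and loc: "\<And>U. openin X U \<Longrightarrow> x \<in> U \<Longrightarrow>
      \<exists>N. openin Y N \<and> img U \<inter> N \<noteq> {} \<and> (\<forall>y \<in> N. b g y = y)"
  shows "a g x = x"
proof (rule ccontr)
  assume "a g x \<noteq> x"
  from A.separate_one[OF g openin_topspace x this]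
  obtain U where U: "openin X U" "x \<in> U" "\<forall>v \<in> U. a g v \<notin> U"
    by (elim exE conjE) (rule that)
  obtain N where N: "openin Y N" "img U \<inter> N \<noteq> {}" "\<forall>y \<in> N. b g y = y"
    using loc[OF U(1,2)] by metis
  then obtain u y where u: "u \<in> carrier G" "A.supp u \<subseteq> U" "y \<in> B.supp u" "y \<in> N"
    unfolding img_def by blast
  have yY: "y \<in> topspace Y" using u B.supp_subset by blast
  have "b g y = y" using u N by blast
  then have "b (inv g) y = y" using g yY by (metis B.act_inv(1))
  then have "y \<in> B.supp (g \<otimes> u \<otimes> inv g)" using u g yY by (simp add: B.supp_conj)
  then have "B.supp (g \<otimes> u \<otimes> inv g) \<inter> B.supp u \<noteq> {}" using u by blast
  then have "A.supp (g \<otimes> u \<otimes> inv g) \<inter> A.supp u \<noteq> {}"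
    using supp_disjoint_iff[of "g \<otimes> u \<otimes> inv g" u] u g by simp
  then obtain z where z: "z \<in> topspace X" "a (inv g) z \<in> A.supp u" "z \<in> A.supp u"
    using u g by (auto simp: A.supp_conj)
  then have "a (inv g) z \<in> U" "z \<in> U" using u by blast+
  then show False using U(3) g z(1) by (metis A.act_inv(2))
qed

text \<open>Placing the near point in the closure of \<open>Q\<close> is what later yields
  continuity.\<close>

lemma near_exists_in_flexible:
  assumes x: "x \<in> topspace X" and S: "strongly_flexible Y (b ` carrier G) S"
    and Q: "openin Y Q" "Q \<subseteq> S" "\<And>U. openin X U \<Longrightarrow> x \<in> U \<Longrightarrow> img U \<inter> Q \<noteq> {}"
  shows "\<exists>y \<in> Y closure_of Q. near x y"
proof -
  obtain U :: "nat \<Rightarrow> 'x set" where U: "\<And>n. openin X (U n)" "\<And>n. x \<in> U n" "decseq U"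
    and base: "\<And>T. openin X T \<Longrightarrow> x \<in> T \<Longrightarrow> \<exists>n. U n \<subseteq> T"
    using first_countable_decreasing_base[OF A.first_countable x] by metis
  have "infinite (img (U n) \<inter> Q)" for n
    using Q U img_open B.no_isolated B.Hausdorff
    by (intro infinite_openin_if_no_isolated[of Y]) blast+
  then obtain y where y: "inj y" "\<And>n. y n \<in> img (U n) \<inter> Q"
    using inj_choice_of_infinite[of "\<lambda>n. img (U n) \<inter> Q"] by metis
  \<comment> \<open>By injectivity an infinite set of values of \<open>y\<close> contains some with
    arbitrarily large index.\<close>
  have large: "\<exists>n. y n \<in> B \<and> U n \<subseteq> T"
    if B: "infinite B" "B \<subseteq> range y" and T: "openin X T" "x \<in> T" for B T
  proof -
    obtain m where m: "U m \<subseteq> T" using base[OF T] by (elim exE) (rule that)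
    have "infinite (B - y ` {..<m})" using B by (intro Diff_infinite_finite) auto
    then obtain z where "z \<in> B - y ` {..<m}" by (metis ex_in_conv infinite_imp_nonempty)
    moreover from this obtain n where "z = y n" using B(2) by auto
    ultimately have n: "y n \<in> B" "\<not> n < m" by auto
    then have "U n \<subseteq> U m" using U(3) by (simp add: decseq_def)
    then show ?thesis using n(1) m by (intro exI[of _ n] conjI) simp_all
  qed
  have "Y derived_set_of (range y) \<noteq> {}"
  proof
    assume "Y derived_set_of (range y) = {}"
    moreover have "infinite (range y)" using y(1) by (simp add: finite_image_iff)
    moreover have "range y \<subseteq> S" using y(2) Q(2) by blast
    ultimately have "\<exists>V. openin Y V \<and> V \<noteq> {} \<and>
        (\<forall>W. openin Y W \<and> W \<noteq> {} \<and> W \<subseteq> V \<longrightarrow>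
          (\<exists>h \<in> b ` carrier G. infinite {z \<in> range y. h z \<in> W} \<and>
            infinite {z \<in> range y. \<exists>N. openin Y N \<and> z \<in> N \<and> (\<forall>u \<in> N. h u = u)}))"
      by (intro S[unfolded strongly_flexible_def, THEN conjunct2, rule_format] conjI)
    then obtain V where V: "openin Y V" "V \<noteq> {}"
      and flex: "\<forall>W. openin Y W \<and> W \<noteq> {} \<and> W \<subseteq> V \<longrightarrow>
          (\<exists>h \<in> b ` carrier G. infinite {z \<in> range y. h z \<in> W} \<and>
            infinite {z \<in> range y. \<exists>N. openin Y N \<and> z \<in> N \<and> (\<forall>u \<in> N. h u = u)})"
      by (elim exE conjE) (rule that)
    \<comment> \<open>Strong flexibility is applied to a \<open>W\<close> that the image of a
      neighbourhood of \<open>x\<close> misses. Since \<open>g\<close> will fix \<open>x\<close>,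
      late \<open>y n\<close> must land both in \<open>W\<close> and in that image.\<close>
    obtain T W where TW: "openin X T" "x \<in> T" "openin Y W" "W \<noteq> {}" "W \<subseteq> V" "img T \<inter> W = {}"
      using separate_in[OF x V] by blast
    obtain g where g: "g \<in> carrier G" and inf: "infinite {z \<in> range y. b g z \<in> W}"
      "infinite {z \<in> range y. \<exists>N. openin Y N \<and> z \<in> N \<and> (\<forall>u \<in> N. b g u = u)}"
      using flex[rule_format, OF conjI[OF TW(3) conjI[OF TW(4,5)]]] by blast
    have gx: "a g x = x"
    proof (rule fixed_if_locally_fixed[OF x g])
      fix U' assume U': "openin X U'" "x \<in> U'"
      obtain n where n: "U n \<subseteq> U'" and "\<exists>N. openin Y N \<and> y n \<in> N \<and> (\<forall>u \<in> N. b g u = u)"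
        using large[OF inf(2) _ U'] by auto
      then obtain N where N: "openin Y N" "y n \<in> N" "\<forall>u \<in> N. b g u = u" by metis
      moreover have "y n \<in> img U'" using y(2) img_mono n(1) by blast
      ultimately show "\<exists>N. openin Y N \<and> img U' \<inter> N \<noteq> {} \<and> (\<forall>y \<in> N. b g y = y)" by blast
    qed
    have "openin X {x \<in> topspace X. a g x \<in> T}" using A.act_preimage_open g TW by blast
    then obtain n where n: "U n \<subseteq> {x \<in> topspace X. a g x \<in> T}" "b g (y n) \<in> W"
      using large[OF inf(1), of "{x \<in> topspace X. a g x \<in> T}"] x gx TW by auto
    have "y n \<in> img {x \<in> topspace X. a g x \<in> T}" using y(2) img_mono[OF n(1)] by blast
    then have "b g (y n) \<in> img T" by (rule img_act[OF g])
    then show False using n TW by blast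
  qed
  then obtain z where z: "z \<in> Y derived_set_of (range y)" by blast
  have acc: "infinite (range y \<inter> V)" if "openin Y V" "z \<in> V" for V
    using z that derived_set_of_infinite_openin[OF B.Hausdorff, of "range y"] by blast
  have "near x z"
    unfolding near_def
  proof (intro conjI allI impI)
    show "z \<in> topspace Y" using z by (simp add: in_derived_set_of)
    fix T V assume TV: "openin X T \<and> x \<in> T \<and> openin Y V \<and> z \<in> V"
    then obtain n where "y n \<in> V" "U n \<subseteq> T" using large[OF acc, of V T] by blast
    then show "img T \<inter> V \<noteq> {}" using y(2) img_mono by blast
  qed (rule x)
  moreover have "z \<in> Y closure_of Q"
  proof -
    have "range y \<subseteq> Q" using y(2) by blast
    then show ?thesis using z derived_set_of_mono[of _ Q Y] derived_set_of_subset_closure_of[of Y Q] by blast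
  qed
  ultimately show ?thesis by blast
qed

text \<open>Some translate of \<open>x\<close> lies in \<open>pre S\<close> for a strongly flexible
  \<open>S\<close>. The previous lemma applies there with \<open>Q\<close> translated and cut down
  to \<open>S\<close>, and nearness is carried back by \<open>inv g\<close>.\<close>

lemma near_exists:
  assumes x: "x \<in> topspace X"
    and Q: "openin Y Q" "\<And>U. openin X U \<Longrightarrow> x \<in> U \<Longrightarrow> img U \<inter> Q \<noteq> {}"
  shows "\<exists>y \<in> Y closure_of Q. near x y"
proof -
  \<comment> \<open>The support condition is vacuous here, so this is the full orbit of
    \<open>x\<close>.\<close>
  let ?O = "{a g x |g. g \<in> carrier G \<and> A.supp g \<subseteq> topspace X}"
  define D where "D = X interior_of (X closure_of ?O)"
  have D: "openin X D" "D \<noteq> {}"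
    using A.orbit_somewhere_dense[OF openin_topspace x] by (auto simp: D_def somewhere_dense_def)
  obtain y0 where y0: "y0 \<in> img D" using img_nonempty D by blast
  then have "y0 \<in> topspace Y" using img_open openin_subset by blast
  then obtain S where S: "y0 \<in> S" "strongly_flexible Y (b ` carrier G) S" using B.cover by blast
  have So: "openin Y S" using S(2) by (simp add: strongly_flexible_def)
  have "D \<inter> pre S \<noteq> {}" using img_meets_iff[OF D(1) So] y0 S(1) by blast
  moreover have "D \<subseteq> X closure_of ?O" by (simp add: D_def interior_of_subset)
  ultimately have "pre S \<inter> X closure_of ?O \<noteq> {}" by blast
  then have "pre S \<inter> ?O \<noteq> {}"
    by (simp only: openin_Int_closure_of_eq_empty[OF pre_open] not_False_eq_True)
  then obtain g where g: "g \<in> carrier G" "a g x \<in> pre S" by blast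
  define Q' where "Q' = {y \<in> topspace Y. b (inv g) y \<in> Q}"
  have Q'o: "openin Y Q'" using B.act_preimage_open g(1) Q(1) by (simp add: Q'_def)
  have meets: "img U \<inter> (Q' \<inter> S) \<noteq> {}" if U: "openin X U" "a g x \<in> U" for U
  proof -
    let ?U = "U \<inter> pre S"
    have "openin X ?U" using U pre_open by blast
    then have "img {x \<in> topspace X. a g x \<in> ?U} \<inter> Q \<noteq> {}"
      using x g U by (intro Q(2) A.act_preimage_open) auto
    then obtain w where w: "w \<in> img {x \<in> topspace X. a g x \<in> ?U}" "w \<in> Q" by blast
    have "w \<in> topspace Y" using w(2) Q(1) openin_subset by blast
    then have "b g w \<in> Q'" using g w(2) by (simp add: Q'_def)
    then have "img ?U \<inter> Q' \<noteq> {}" using img_act[OF g(1) w(1)] by blast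
    then have "img ?U \<inter> Q' \<inter> S \<noteq> {}" using img_subset_closure Q'o by (metis Int_lower2)
    then show ?thesis using img_mono[of ?U U] by blast
  qed
  have "\<exists>y \<in> Y closure_of (Q' \<inter> S). near (a g x) y"
    by (rule near_exists_in_flexible[OF _ S(2)]) (use meets Q'o So x g in auto)
  then obtain y where y: "y \<in> Y closure_of (Q' \<inter> S)" "near (a g x) y" by blast
  have "near x (b (inv g) y)" using near_act[of "inv g", OF _ y(2)] g x by simp
  moreover have "b (inv g) y \<in> Y closure_of (b (inv g) ` (Q' \<inter> S))"
    using continuous_map_image_closure_subset[OF B.act_cont[of "inv g"]] g y(1) by blast
  moreover have "b (inv g) ` (Q' \<inter> S) \<subseteq> Q" by (auto simp: Q'_def)
  ultimately show ?thesis
    using closure_of_mono[of "b (inv g) ` (Q' \<inter> S)" Q Y] by (intro bexI[of _ "b (inv g) y"]) auto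
qed

lemma near_unique:
  assumes "near x y" "near x z"
  shows "y = z"
proof (rule ccontr)
  assume "y \<noteq> z"
  note xyz = nearD(1,2)[OF assms(1)] nearD(2)[OF assms(2)]
  obtain P R where PR: "openin Y P" "openin Y R" "y \<in> P" "z \<in> R" "disjnt P R"
    using B.Hausdorff xyz \<open>y \<noteq> z\<close> unfolding Hausdorff_space_def by metis
  let ?O = "{b g y |g. g \<in> carrier G \<and> B.supp g \<subseteq> P}"
  define D where "D = Y interior_of (Y closure_of ?O)"
  have D: "openin Y D" "D \<noteq> {}"
    using B.orbit_somewhere_dense[OF PR(1,3)] by (auto simp: D_def somewhere_dense_def)
  \<comment> \<open>No point of \<open>W\<close> is near \<open>x\<close>, whereas the orbit of
    \<open>y\<close>, dense in \<open>D\<close>, has a point in \<open>W\<close>.\<close>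
  obtain U W where UW: "openin X U" "x \<in> U" "openin Y W" "W \<noteq> {}" "W \<subseteq> D" "img U \<inter> W = {}"
    using separate_in[OF xyz(1) D] by blast
  have "D \<subseteq> Y closure_of ?O" by (simp add: D_def interior_of_subset)
  then have "W \<inter> Y closure_of ?O \<noteq> {}" using UW by blast
  then have "W \<inter> ?O \<noteq> {}"
    by (simp only: openin_Int_closure_of_eq_empty[OF UW(3)] not_False_eq_True)
  then obtain g where g: "g \<in> carrier G" "B.supp g \<subseteq> P" "b g y \<in> W" by blast
  have fixR: "\<forall>w \<in> R. b g w = w"
  proof
    fix w assume "w \<in> R"
    then have "w \<notin> B.supp g" "w \<in> topspace Y"
      using g(2) PR(5) openin_subset[OF PR(2)] by (auto simp: disjnt_iff)
    then show "b g w = w" by (simp add: B.supp_def)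
  qed
  have "a g x = x"
  proof (rule fixed_if_locally_fixed[OF xyz(1) g(1)])
    fix U assume "openin X U" "x \<in> U"
    then have "img U \<inter> R \<noteq> {}" using nearD(3)[OF assms(2)] PR by simp
    then show "\<exists>N. openin Y N \<and> img U \<inter> N \<noteq> {} \<and> (\<forall>y \<in> N. b g y = y)"
      using fixR PR(2) by (intro exI[of _ R]) simp
  qed
  then have "near x (b g y)" using near_act[OF g(1) assms(1)] by simp
  then show False using UW g(3) nearD(3) by metis
qed

section \<open>The homeomorphism and its equivariance\<close>

definition tau :: "'x \<Rightarrow> 'y"
  where "tau x = (THE y. near x y)"

lemma near_tau: assumes "x \<in> topspace X" shows "near x (tau x)"
proof -
  have "\<exists>y \<in> Y closure_of topspace Y. near x y"
  proof (rule near_exists[OF assms openin_topspace])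
    fix U assume "openin X U" "x \<in> U"
    then have "img U \<noteq> {}" using img_nonempty by blast
    then show "img U \<inter> topspace Y \<noteq> {}" using img_open[of U] openin_subset by blast
  qed
  then obtain y where "near x y" by blast
  then show ?thesis
    unfolding tau_def by (rule theI) (rule near_unique[OF _ \<open>near x y\<close>])
qed

lemma tau_eq: "near x y \<Longrightarrow> tau x = y"
  using near_unique near_tau nearD(1) by metis

lemma tau_act:
  assumes "g \<in> carrier G" "x \<in> topspace X"
  shows "tau (a g x) = b g (tau x)"
  by (intro tau_eq near_act near_tau assms)

text \<open>Regularity gives a neighbourhood \<open>P\<close> of \<open>tau x\<close> with closure
  inside \<open>V\<close>. If every image of a neighbourhood of \<open>x\<close> met the complement
  of that closure, \<open>near_exists\<close> would give a point near \<open>x\<close> outside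
  \<open>P\<close>, against uniqueness.\<close>

lemma tau_continuous: "continuous_map X Y tau"
proof (subst continuous_map_eq_topcontinuous_at, rule ballI)
  fix x assume x: "x \<in> topspace X"
  show "topcontinuous_at X Y tau x"
    unfolding topcontinuous_at_def
  proof (intro conjI allI impI)
    show "x \<in> topspace X" by (rule x)
    show "tau \<in> topspace X \<rightarrow> topspace Y" using near_tau nearD(2) by auto
    fix V assume V: "openin Y V \<and> tau x \<in> V"
    then have "closedin Y (topspace Y - V)" "tau x \<in> topspace Y - (topspace Y - V)"
      using nearD(2)[OF near_tau[OF x]] by auto
    then obtain P where P: "openin Y P" "tau x \<in> P" "disjnt (topspace Y - V) (Y closure_of P)"
      using B.regular unfolding regular_space by metis
    let ?Q = "topspace Y - Y closure_of P"
    have Q: "openin Y ?Q" by (simp add: openin_diff)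
    have "P \<inter> ?Q = {}" using closure_of_subset[OF openin_subset[OF P(1)]] by blast
    then have "P \<inter> Y closure_of ?Q = {}" using openin_Int_closure_of_eq_empty[OF P(1)] by blast
    then have "\<not> (\<exists>y \<in> Y closure_of ?Q. near x y)" using tau_eq P(2) by blast
    then obtain U where U: "openin X U" "x \<in> U" "img U \<inter> ?Q = {}"
      using near_exists[OF x Q] by blast
    have "tau x' \<in> V" if "x' \<in> U" for x'
    proof -
      have "x' \<in> topspace X" using that U openin_subset by blast
      then have n: "near x' (tau x')" by (rule near_tau)
      then have "tau x' \<notin> ?Q" using U that nearD(3)[OF n U(1) _ Q] by auto
      moreover have "tau x' \<in> topspace Y" using n by (rule nearD)
      ultimately show ?thesis using P(3) unfolding disjnt_iff by blast
    qed
    then show "\<exists>U. openin X U \<and> x \<in> U \<and> (\<forall>y \<in> U. tau y \<in> V)" using U by blast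
  qed
qed

text \<open>The locale is symmetric in the two spaces, so the map built after swapping them is
  continuous as well, and symmetry of nearness makes it the inverse.\<close>

lemma tau_homeomorphic: "homeomorphic_map X Y tau"
proof -
  interpret swap: K_F_pair G Y b X a by unfold_locales
  have pre: "swap.img = pre" by (intro ext) (simp add: swap.img_def pre_def)
  have near_iff: "swap.near y x \<longleftrightarrow> near x y" for x y
  proof -
    have "pre V \<inter> U \<noteq> {} \<longleftrightarrow> img U \<inter> V \<noteq> {}" if "openin X U" "openin Y V" for U V
      using img_meets_iff[OF that] by (simp add: Int_commute)
    then show ?thesis unfolding near_def swap.near_def pre by metis
  qed
  have "swap.tau (tau x) = x" if "x \<in> topspace X" for x
    using near_tau[OF that] by (intro swap.tau_eq) (simp add: near_iff)
  moreover have "tau (swap.tau y) = y" if "y \<in> topspace Y" for y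
    using swap.near_tau[OF that] by (intro tau_eq) (simp add: near_iff)
  ultimately have "homeomorphic_maps X Y tau swap.tau"
    unfolding homeomorphic_maps_def using tau_continuous swap.tau_continuous by blast
  then show ?thesis using homeomorphic_maps_imp_map by blast
qed

end

lemma homeo_action_restrict:
  assumes "subgroup S (homeo_group X)" "group G" "act \<in> iso G ((homeo_group X)\<lparr>carrier := S\<rparr>)"
    and "Hausdorff_space X"
  shows "homeo_action G X act"
proof -
  have "S \<subseteq> carrier (homeo_group X)" using assms(1) by (rule subgroup.subset)
  then have "act \<in> hom G (homeo_group X)" "inj_on act (carrier G)"
    using assms(3) by (auto simp: iso_def hom_def bij_betw_def)
  then show ?thesis
    using assms by (simp add: homeo_action_def homeo_action_axioms_def)
qed

theorem theoremB:
  shows "faithful (K_F :: ('a topology \<times> ('a \<Rightarrow> 'a) set) set)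
                  (K_F :: ('b topology \<times> ('b \<Rightarrow> 'b) set) set)"
  unfolding faithful_def
proof clarify
  fix X :: "'a topology" and G and Y :: "'b topology" and H \<phi>
  assume X: "(X, G) \<in> K_F" and Y: "(Y, H) \<in> K_F"
    and \<phi>: "\<phi> \<in> iso ((homeo_group X)\<lparr>carrier := G\<rparr>) ((homeo_group Y)\<lparr>carrier := H\<rparr>)"
  let ?G = "(homeo_group X)\<lparr>carrier := G\<rparr>"
  have G: "subgroup G (homeo_group X)" and H: "subgroup H (homeo_group Y)"
    and T2: "Hausdorff_space X" "Hausdorff_space Y"
    using X Y by (auto simp: K_F_def space_group_pair_def)
  have grp: "group ?G" using subgroup.subgroup_is_group[OF G group_homeo_group] .
  have \<phi>H: "\<phi> ` G = H" using \<phi> by (auto simp: iso_def bij_betw_def)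
  have A: "homeo_action ?G X (\<lambda>g. g)"
    by (rule homeo_action_restrict[OF G grp _ T2(1)]) (auto simp: iso_def hom_def bij_betw_def)
  have B: "homeo_action ?G Y \<phi>"
    by (rule homeo_action_restrict[OF H grp \<phi> T2(2)])
  \<comment> \<open>The source group acts on \<open>X\<close> tautologically and on \<open>Y\<close>
    through the isomorphism.\<close>
  interpret K_F_pair ?G X "\<lambda>g. g" Y \<phi>
    using A B X Y \<phi>H by (simp add: K_F_pair_def K_F_action_def K_F_action_axioms_def)
  have inj: "inj_on tau (topspace X)" and surj: "tau ` topspace X = topspace Y"
    using tau_homeomorphic by (simp_all add: homeomorphic_eq_everything_map)
  have "\<phi> g = restrict (tau \<circ> g \<circ> inv_into (topspace X) tau) (topspace Y)" if g: "g \<in> G" for g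
  \<comment> \<open>Both sides are extensional; on \<open>Y\<close> the equation is equivariance of
    \<open>tau\<close> at the point that \<open>tau\<close> sends to \<open>y\<close>.\<close>
  proof (rule extensionalityI[of _ "topspace Y"])
    show "\<phi> g \<in> extensional (topspace Y)" using B.act_extensional g by simp
    fix y assume y: "y \<in> topspace Y"
    then have "inv_into (topspace X) tau y \<in> topspace X" "tau (inv_into (topspace X) tau y) = y"
      using surj by (auto simp: inv_into_into f_inv_into_f)
    then show "\<phi> g y = restrict (tau \<circ> g \<circ> inv_into (topspace X) tau) (topspace Y) y"
      using tau_act[of g] g y by simp
  qed simp
  then show "\<exists>\<tau>. homeomorphic_map X Y \<tau> \<and>
      (\<forall>g \<in> G. \<phi> g = restrict (\<tau> \<circ> g \<circ> inv_into (topspace X) \<tau>) (topspace Y))"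
    using tau_homeomorphic by blast
qed

end
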